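(* There exists an absolute constant $C>0$ such that for every $N$ there is a convex set $A\subset\mathbb{R}$ with $|A|\geq N$ and $S(A)\leq C|A|^{3/4}$.
   Context: A convex set is a finite set $A=\{a_1<\cdots<a_n\}\subset\mathbb{R}$ whose consecutive differences $a_{i+1}-a_i$ form a strictly increasing sequence. A set $B$ is Sidon if the only solutions of $a+b=c+d$ with $a,b,c,d\in B$ have $\{a,b\}=\{c,d\}$. $S(A)=\max\{|B|: B\subseteq A,\ B\text{ Sidon}\}$. *)

theory Defs
  imports Complex_Main
begin

(* Convexity in the sense of additive combinatorics, unrelated to the library constant convex.
   The list sorted_list_of_set A is a_1 < ... < a_n, indexed from 0. *)
definition convex_set :: "real set \<Rightarrow> bool" where
  "convex_set A \<longleftrightarrow> finite A \<and>
     (let a = sorted_list_of_set A in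
        \<forall>i j. i < j \<and> Suc j < card A \<longrightarrow> a ! Suc i - a ! i < a ! Suc j - a ! j)"

definition sidon :: "real set \<Rightarrow> bool" where
  "sidon B \<longleftrightarrow> (\<forall>a\<in>B. \<forall>b\<in>B. \<forall>c\<in>B. \<forall>d\<in>B. a + b = c + d \<longrightarrow> {a, b} = {c, d})"

(* Meaningful for finite A only: the set under Max is then finite, and it contains card {} = 0. *)
definition max_sidon :: "real set \<Rightarrow> nat" where
  "max_sidon A = Max {card B | B. B \<subseteq> A \<and> sidon B}"

end

(* The Sidon bound is a graph argument: if A is contained in a sumset X + Y with
   |X|, |Y| = O(m), then a Sidon subset of A, seen as a set of pairs in X x Y, contains no
   rectangle (a rectangle is a nontrivial solution of a + b = c + d), so by Cauchy-Schwarz it has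
   O(m^(3/2)) elements. It remains to find a convex A of size at least 2 m^2 in such a sumset.
   Up to a linear term take x_i = i^2 and y_j = - j^2. On the antidiagonal i + j = s the sum
   x_i + y_j = (2 i - s) s runs through an arithmetic progression of step 2 s, so the steps grow
   with s. A divisibility choice of the end points makes consecutive progressions fit together
   with a step 2 s + 1, and a tiny multiple of i^2 added to x_i makes each progression strictly
   convex. *)

theory Submission
  imports Defs "HOL-Analysis.Convex"
begin

section \<open>Lists of consecutive differences and convexity\<close>

fun gaps :: "real list \<Rightarrow> real list" where
  "gaps (x # y # ys) = (y - x) # gaps (y # ys)"
| "gaps _ = []"

lemma gaps_append:
  assumes "xs \<noteq> []" "ys \<noteq> []"
  shows "gaps (xs @ ys) = gaps xs @ (hd ys - last xs) # gaps ys"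
  using assms by (induction xs rule: gaps.induct) (auto simp: neq_Nil_conv)

lemma gaps_map_upt: "gaps (map f [l..<Suc r]) = map (\<lambda>i. f (Suc i) - f i) [l..<r]"
proof (induction r)
  case (Suc r)
  show ?case
  proof (cases "l \<le> r")
    case True
    then have "map f [l..<Suc (Suc r)] = map f [l..<Suc r] @ [f (Suc r)]"
      by simp
    then have "gaps (map f [l..<Suc (Suc r)]) =
        gaps (map f [l..<Suc r]) @ [f (Suc r) - last (map f [l..<Suc r])]"
      using True by (simp only:, subst gaps_append) auto
    also have "last (map f [l..<Suc r]) = f r"
      using True by simp
    finally show ?thesis
      using Suc.IH True by simp
  qed (auto simp: not_le)
qed auto

lemma length_gaps: "length (gaps xs) = length xs - 1"
  by (induction xs rule: gaps.induct) auto

lemma nth_gaps: "Suc i < length xs \<Longrightarrow> gaps xs ! i = xs ! Suc i - xs ! i"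
proof (induction xs arbitrary: i rule: gaps.induct)
  case (1 x y ys)
  then show ?case by (cases i) auto
qed auto

lemma sorted_if_gaps_pos:
  "\<forall>d\<in>set (gaps xs). 0 < d \<Longrightarrow> sorted_wrt (<) xs"
proof (induction xs rule: gaps.induct)
  case (1 x y ys)
  then show ?case by fastforce
qed auto

text \<open>Positive gaps make \<open>xs\<close> strictly increasing, so \<open>xs\<close> is the
  sorted list of its own set and the definition of convexity can be read off
  \<open>gaps xs\<close>.\<close>

lemma convex_set_set:
  assumes "sorted_wrt (<) (gaps xs)" and "\<forall>d\<in>set (gaps xs). 0 < d"
  shows "convex_set (set xs)" and "card (set xs) = length xs"
proof -
  have s: "sorted_wrt (<) xs"
    using assms(2) by (rule sorted_if_gaps_pos)
  then have xs: "sorted_list_of_set (set xs) = xs"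
    by (simp add: sorted_list_of_set.idem_if_sorted_distinct strict_sorted_iff)
  show card: "card (set xs) = length xs"
    using s by (simp add: distinct_card strict_sorted_iff)
  show "convex_set (set xs)"
    unfolding convex_set_def Let_def xs card
  proof (intro conjI allI impI)
    fix i j
    assume *: "i < j \<and> Suc j < length xs"
    then have "gaps xs ! i < gaps xs ! j"
      using assms(1) by (auto simp: sorted_wrt_iff_nth_less length_gaps)
    then show "xs ! Suc i - xs ! i < xs ! Suc j - xs ! j"
      using * by (simp add: nth_gaps)
  qed auto
qed

text \<open>For gluing rows: the gaps inside row \<open>s\<close> lie strictly between
  \<open>u s\<close> and \<open>v s\<close>, and the joining gap fits between \<open>v s\<close> and
  \<open>u (Suc s)\<close>, so it separates the gaps of one row from those of the next.\<close>

lemma sorted_gaps_concat: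
  fixes row :: "nat \<Rightarrow> real list" and u v :: "nat \<Rightarrow> real"
  assumes ab: "a \<le> b"
    and ne: "\<And>s. a \<le> s \<Longrightarrow> s \<le> b \<Longrightarrow> row s \<noteq> []"
    and uv: "\<And>s. u s < v s"
    and row: "\<And>s. a \<le> s \<Longrightarrow> s \<le> b \<Longrightarrow> sorted_wrt (<) (gaps (row s))"
    and rng: "\<And>s. a \<le> s \<Longrightarrow> s \<le> b \<Longrightarrow> set (gaps (row s)) \<subseteq> {u s<..<v s}"
    and gap: "\<And>s. a \<le> s \<Longrightarrow> s < b \<Longrightarrow> hd (row (Suc s)) - last (row s) \<in> {v s..u (Suc s)}"
  defines "L \<equiv> \<lambda>t. concat (map row [a..<Suc t])"
  shows "sorted_wrt (<) (gaps (L b))" and "set (gaps (L b)) \<subseteq> {u a<..<v b}"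
proof -
  \<comment> \<open>Nonemptiness and the last entry feed \<open>gaps_append\<close>;
    \<open>u a \<le> u t\<close> keeps the gaps of later rows above \<open>u a\<close>.\<close>
  have "t \<le> b \<Longrightarrow> L t \<noteq> [] \<and> last (L t) = last (row t) \<and> sorted_wrt (<) (gaps (L t)) \<and>
      u a \<le> u t \<and> set (gaps (L t)) \<subseteq> {u a<..<v t}" if "a \<le> t" for t
    using that
  proof (induction t rule: dec_induct)
    case base
    then show ?case using ne row rng by (simp add: L_def)
  next
    case (step t)
    have L: "L (Suc t) = L t @ row (Suc t)"
      using step.hyps by (simp add: L_def)
    note IH = step.IH[OF Suc_leD[OF step.prems]]
    have n: "row (Suc t) \<noteq> []"
      using ne step by simp
    have d: "gaps (L (Suc t)) =
        gaps (L t) @ (hd (row (Suc t)) - last (row t)) # gaps (row (Suc t))"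
      unfolding L using IH n by (simp add: gaps_append)
    have g: "hd (row (Suc t)) - last (row t) \<in> {v t..u (Suc t)}"
      using gap step by simp
    have r: "sorted_wrt (<) (gaps (row (Suc t)))"
        "set (gaps (row (Suc t))) \<subseteq> {u (Suc t)<..<v (Suc t)}"
      using row rng step by simp_all
    show ?case
      unfolding d sorted_wrt_append using IH g r uv[of t] uv[of "Suc t"] n
      by (fastforce simp: L)
  qed
  from this[OF ab order_refl] show "sorted_wrt (<) (gaps (L b))" "set (gaps (L b)) \<subseteq> {u a<..<v b}"
    by auto
qed

section \<open>Sidon subsets of a sumset\<close>

lemma rectangle_free_card:
  fixes P :: "('a \<times> 'b) set"
  assumes fin: "finite I" "finite J" and P: "P \<subseteq> I \<times> J"
    and free: "\<And>i i' j j'. (i, j) \<in> P \<Longrightarrow> (i, j') \<in> P \<Longrightarrow> (i', j) \<in> P \<Longrightarrow> (i', j') \<in> P \<Longrightarrow>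
      i = i' \<or> j = j'"
  shows "(card P)\<^sup>2 \<le> card I * (card P + (card J)\<^sup>2)"
proof -
  define d where "d i = {j. (i, j) \<in> P}" for i
  have dJ: "d i \<subseteq> J" for i
    using P by (auto simp: d_def)
  have find: "finite (d i)" for i
    using dJ fin(2) by (rule finite_subset)
  have "P = Sigma I d"
    using P by (auto simp: d_def)
  then have cP: "card P = (\<Sum>i\<in>I. card (d i))"
    using fin find by simp
  \<comment> \<open>\<open>T\<close> consists of the pairs of points of \<open>P\<close> in a common
    row, and \<open>D\<close> is its diagonal \<open>j = j'\<close>. Off the diagonal,
    rectangle-freeness lets \<open>(j, j')\<close> determine \<open>i\<close>.\<close>
  define T where "T = Sigma I (\<lambda>i. d i \<times> d i)"
  define D where "D = (\<lambda>(i, j). (i, j, j)) ` P"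
  have finT: "finite T" "finite P"
    using fin find finite_subset[OF P] by (auto simp: T_def)
  have "inj_on snd (T - D)"
  proof (rule inj_onI)
    fix s t
    assume *: "s \<in> T - D" "t \<in> T - D" "snd s = snd t"
    obtain i j j' i' where st: "s = (i, j, j')" "t = (i', j, j')"
      using *(3) by (metis surj_pair snd_conv)
    then have "(i, j) \<in> P" "(i, j') \<in> P" "(i', j) \<in> P" "(i', j') \<in> P"
      using * by (auto simp: T_def d_def)
    moreover have "j \<noteq> j'"
      using *(1) calculation(1) unfolding st D_def by force
    ultimately show "s = t"
      using free st by blast
  qed
  moreover have "snd ` (T - D) \<subseteq> J \<times> J"
    using dJ by (fastforce simp: T_def)
  ultimately have "card (T - D) \<le> card (J \<times> J)"
    using fin by (intro card_inj_on_le) auto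
  moreover have "card D \<le> card P"
    unfolding D_def using finT by (intro card_image_le)
  moreover have "card T \<le> card (T - D) + card D"
    using finT diff_card_le_card_Diff[of D T] by (simp add: D_def)
  ultimately have T: "card T \<le> card P + (card J)\<^sup>2"
    by (simp add: power2_eq_square card_cartesian_product)
  \<comment> \<open>Cauchy-Schwarz over the rows, whose sum of squares counts
    \<open>T\<close>.\<close>
  have "real ((card P)\<^sup>2) = (\<Sum>i\<in>I. real (card (d i)))\<^sup>2"
    by (simp add: cP)
  also have "\<dots> \<le> (\<Sum>i\<in>I. (real (card (d i)))\<^sup>2) * card I"
    by (rule sum_squared_le_sum_of_squares)
  also have "(\<Sum>i\<in>I. (real (card (d i)))\<^sup>2) = card T"
    using fin find by (simp add: T_def power2_eq_square)
  finally have "(card P)\<^sup>2 \<le> card T * card I"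
    by (metis of_nat_le_iff of_nat_mult)
  also have "\<dots> \<le> (card P + (card J)\<^sup>2) * card I"
    using T by simp
  finally show ?thesis
    by (simp add: mult.commute)
qed

text \<open>Choose one representing pair for each element of \<open>B\<close>. Opposite corners of a
  rectangle have equal sums, so the Sidon property gives two adjacent corners the same value; each
  value has only one chosen pair, so these corners coincide.\<close>

lemma sidon_sumset_card:
  assumes fin: "finite I" "finite J" and B: "sidon B" "B \<subseteq> (\<lambda>(i, j). x i + y j) ` (I \<times> J)"
  shows "(card B)\<^sup>2 \<le> card I * (card B + (card J)\<^sup>2)"
proof -
  define val where "val = (\<lambda>(i, j). x i + y j)"
  define h where "h = inv_into (I \<times> J) val"
  have v: "val (h b) = b" and hI: "h b \<in> I \<times> J" if "b \<in> B" for b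
    using that B(2) unfolding h_def val_def
    by (auto intro!: f_inv_into_f inv_into_into simp del: mem_Sigma_iff)
  have "inj_on h B"
    using v by (metis inj_onI)
  then have c: "card (h ` B) = card B"
    by (rule card_image)
  have P: "val p \<in> B \<and> h (val p) = p" if "p \<in> h ` B" for p
    using that v by auto
  have "(card (h ` B))\<^sup>2 \<le> card I * (card (h ` B) + (card J)\<^sup>2)"
  proof (rule rectangle_free_card[OF fin])
    show "h ` B \<subseteq> I \<times> J"
      using hI by blast
  next
    fix i i' j j'
    assume *: "(i, j) \<in> h ` B" "(i, j') \<in> h ` B" "(i', j) \<in> h ` B" "(i', j') \<in> h ` B"
    have "val (i, j) + val (i', j') = val (i, j') + val (i', j)"
      by (simp add: val_def)
    then have "{val (i, j), val (i', j')} = {val (i, j'), val (i', j)}"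
      using B(1) P * unfolding sidon_def by meson
    then have "val (i, j) = val (i, j') \<or> val (i, j) = val (i', j)"
      by blast
    then show "i = i' \<or> j = j'"
      using P * by (metis prod.inject)
  qed
  then show ?thesis
    by (simp add: c)
qed

text \<open>With w = M^(3/2), p > 2 w would give p^2 > w p + w p \<ge> M p + w^2 = M p +
  M^3.\<close>

lemma quadratic_bound:
  fixes p M :: real
  assumes "1 \<le> M" "p\<^sup>2 \<le> M * (p + M\<^sup>2)"
  shows "p \<le> 2 * M powr (3 / 2)"
proof (rule ccontr)
  define w where "w = M powr (3 / 2)"
  assume "\<not> ?thesis"
  then have p: "p > 2 * w" by (simp add: w_def)
  have "w * w = M powr 3"
    unfolding w_def by (simp flip: powr_add)
  then have ww: "w * w = M ^ 3"
    using assms(1) by simp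
  have wM: "M \<le> w"
    unfolding w_def using powr_mono[of 1 "3/2" M] assms(1) by simp
  have "p * p > 2 * w * p"
    using p wM assms(1) by (intro mult_strict_right_mono) auto
  moreover have "M * p \<le> w * p"
    using p wM assms(1) by (intro mult_right_mono) auto
  moreover have "w * w \<le> w * p"
    using p wM assms(1) by (intro mult_left_mono) auto
  ultimately show False
    using assms(2) ww by (simp add: power2_eq_square power3_eq_cube algebra_simps)
qed

section \<open>A large convex set inside a small sumset\<close>

lemma convex_in_sumset:
  fixes m :: nat
  assumes m: "1 \<le> m"
  obtains A :: "real set" and x :: "nat \<Rightarrow> real" and y :: "int \<Rightarrow> real"
  where "convex_set A" "2 * m\<^sup>2 \<le> card A"
    "A \<subseteq> (\<lambda>(i, j). x i + y j) ` ({..10 * m} \<times> {-10 * int m..2 * int m})"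
proof -
  text \<open>Row \<open>s\<close> consists of the points \<open>x i + y (s - i)\<close> with \<open>l s \<le> i \<le> r s\<close>. The end points are chosen
    so that, without the term in \<open>\<delta>\<close>, the step from row \<open>s\<close> to row \<open>s + 1\<close> is exactly \<open>2 s + 1\<close>.\<close>
  define F where "F = 8 * m\<^sup>2"
  \<comment> \<open>Small enough that multiplying by it the square of any index in use gives less
    than 1/2.\<close>
  define \<delta> :: real where "\<delta> = 1 / (2 * (10 * real m + 1)\<^sup>2)"
  define l where "l s = (s - 1) - F mod (s - 1)" for s
  define r where "r s = l (Suc s) + (F div s - 1)" for s
  define a where
    "a s i = 2 * (real F + 1) * real s + 2 * real i * real s - (real s)\<^sup>2 + \<delta> * (real i)\<^sup>2" for s i
  \<comment> \<open>On \<open>i + j = s\<close> the linear terms add up to 2 (F + 1) s: they shift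
    whole rows and leave the steps inside a row alone. The argument of \<open>y\<close> is an
    integer because \<open>s - i\<close> can be negative.\<close>
  define x where "x i = 2 * (real F + 1) * real i + (1 + \<delta>) * (real i)\<^sup>2" for i
  define y where "y j = 2 * (real F + 1) * of_int j - (of_int j)\<^sup>2" for j
  define row where "row s = map (a s) [l s..<Suc (r s)]" for s
  define A where "A = set (concat (map row [Suc m..<Suc (2 * m)]))"
  have a: "a s i = x i + y (int s - int i)" for s i
    by (simp add: a_def x_def y_def power2_eq_square algebra_simps)

  have l: "l s \<le> 2 * m" if "s \<le> Suc (2 * m)" for s
    using that by (simp add: l_def)
  \<comment> \<open>This is why \<open>F\<close> is 8 m^2: the quotient is large enough for rows of
    length at least 2 m, yet keeps all indices O(m).\<close>
  have q: "4 * m \<le> F div s" "F div s \<le> 8 * m" if "m \<le> s" "s \<le> 2 * m" for s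
  proof -
    have "4 * m * s \<le> F"
      using mult_left_mono[OF that(2), of "4 * m"] by (simp add: F_def power2_eq_square)
    then show "4 * m \<le> F div s"
      using that m by (simp add: less_eq_div_iff_mult_less_eq)
    have "F \<le> 8 * m * s"
      using mult_left_mono[OF that(1), of "8 * m"] by (simp add: F_def power2_eq_square)
    then show "F div s \<le> 8 * m"
      using that m by (metis div_le_mono div_mult_self_is_m less_le_trans zero_less_one less_le_trans)
  qed
  have r: "4 * m \<le> r s" "r s \<le> 10 * m - 1" if "m \<le> s" "s \<le> 2 * m" for s
  proof -
    have "1 \<le> l (Suc s)"
      using that m mod_less_divisor[of s F] by (simp add: l_def Suc_le_eq)
    then show "4 * m \<le> r s" "r s \<le> 10 * m - 1"
      using q[OF that] l[of "Suc s"] that m by (auto simp: r_def)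
  qed
  \<comment> \<open>Without \<open>\<delta>\<close>, this says that the step from row
    \<open>s\<close> to the next is 2 s + 1. Modulo s it requires l (s + 1) = -F, which the choice s
    - F mod s satisfies; solving for \<open>r s\<close> then gives its definition.\<close>
  have eq: "real (l (Suc s)) * (real s + 1) + real F = real (r s) * real s + 2 * real s"
    if "m \<le> s" "s \<le> 2 * m" for s
  proof -
    have s: "F mod s < s" "1 \<le> F div s"
      using q[OF that] that m by auto
    have "real F = real (F div s) * real s + real (F mod s)"
      by (metis of_nat_add of_nat_mult div_mult_mod_eq)
    then show ?thesis
      using s by (simp add: r_def l_def of_nat_diff algebra_simps)
  qed

  have \<delta>: "0 < \<delta>" "\<delta> * (10 * real m + 1)\<^sup>2 = 1 / 2"
    using m by (auto simp: \<delta>_def)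
  have small: "\<delta> * z < 1 / 2" if "z < (10 * real m + 1)\<^sup>2" for z
    using mult_strict_left_mono[OF that \<delta>(1)] \<delta>(2) by simp

  have step: "a s (Suc i) - a s i = 2 * real s + \<delta> * (2 * real i + 1)" for s i
    by (simp add: a_def power2_eq_square algebra_simps)
  have dr: "gaps (row s) = map (\<lambda>i. 2 * real s + \<delta> * (2 * real i + 1)) [l s..<r s]" for s
    unfolding row_def gaps_map_upt step ..
  have lr: "l s \<le> r s" if "Suc m \<le> s" "s \<le> 2 * m" for s
    using l[of s] r(1)[of s] that by simp
  \<comment> \<open>The joining gap is near 2 s + 1, hence between \<open>v s\<close> = 2 s + 1/2
    and \<open>u (Suc s)\<close> = 2 s + 2.\<close>
  define u v where "u s = 2 * real s" and "v s = 2 * real s + 1 / 2" for s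
  have ends: "Suc m \<le> 2 * m"
    using m by simp
  have row_ne: "row s \<noteq> []" if "Suc m \<le> s" "s \<le> 2 * m" for s
    using lr[OF that] by (simp add: row_def)
  have uv: "u s < v s" for s
    by (simp add: u_def v_def)
  have row_sorted: "sorted_wrt (<) (gaps (row s))" for s
    unfolding dr sorted_wrt_map
    by (rule sorted_wrt_mono_rel[OF _ sorted_wrt_upt]) (use \<delta> in auto)
  have row_range: "set (gaps (row s)) \<subseteq> {u s<..<v s}" if "Suc m \<le> s" "s \<le> 2 * m" for s
  proof -
    have "\<delta> * (2 * real i + 1) < 1 / 2" if "i < r s" for i
    proof (rule small)
      have "i \<le> 10 * m"
        using that r(2)[of s] \<open>Suc m \<le> s\<close> \<open>s \<le> 2 * m\<close> by simp
      then have "real i \<le> 10 * real m"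
        by linarith
      moreover have "0 < (real m)\<^sup>2"
        using m by simp
      moreover have "(10 * real m + 1)\<^sup>2 = 100 * (real m)\<^sup>2 + 20 * real m + 1"
        by (simp add: power2_eq_square algebra_simps)
      ultimately show "2 * real i + 1 < (10 * real m + 1)\<^sup>2"
        by linarith
    qed
    then show ?thesis
      using \<delta>(1) by (auto simp: dr u_def v_def add_nonneg_pos)
  qed
  have row_gap: "hd (row (Suc s)) - last (row s) \<in> {v s..u (Suc s)}" if "Suc m \<le> s" "s < 2 * m" for s
  proof -
    define L R where "L = real (l (Suc s))" and "R = real (r s)"
    have "hd (row (Suc s)) = a (Suc s) (l (Suc s))" "last (row s) = a s (r s)"
      using lr[of s] lr[of "Suc s"] that by (simp_all add: row_def hd_map last_map del: upt_Suc)
    then have "hd (row (Suc s)) - last (row s) =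
        2 * (L * (real s + 1) + real F - R * real s) - 2 * real s + 1 + \<delta> * (L\<^sup>2 - R\<^sup>2)"
      by (simp add: a_def L_def R_def power2_eq_square algebra_simps)
    also have "\<dots> = 2 * real s + 1 + \<delta> * (L\<^sup>2 - R\<^sup>2)"
      using eq[of s] that by (simp add: L_def R_def)
    finally have h: "hd (row (Suc s)) - last (row s) = 2 * real s + 1 + \<delta> * (L\<^sup>2 - R\<^sup>2)" .
    \<comment> \<open>The perturbation is a difference of two numbers in [0, 1/2), so it moves 2 s +
      1 by less than 1/2.\<close>
    have "l (Suc s) < 10 * m + 1" "r s < 10 * m + 1"
      using l[of "Suc s"] r(2)[of s] that m by auto
    then have "L < 10 * real m + 1" "R < 10 * real m + 1"
      unfolding L_def R_def by linarith+
    then have "L\<^sup>2 < (10 * real m + 1)\<^sup>2" "R\<^sup>2 < (10 * real m + 1)\<^sup>2"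
      by (auto intro!: power_strict_mono simp: L_def R_def)
    then have "\<delta> * L\<^sup>2 < 1 / 2" "\<delta> * R\<^sup>2 < 1 / 2"
      by (blast intro: small)+
    moreover have "0 \<le> \<delta> * L\<^sup>2" "0 \<le> \<delta> * R\<^sup>2"
      using \<delta>(1) by auto
    ultimately show ?thesis
      unfolding h u_def v_def right_diff_distrib by simp
  qed
  have D: "sorted_wrt (<) (gaps (concat (map row [Suc m..<Suc (2 * m)])))"
    by (rule sorted_gaps_concat(1)[of _ _ row u v]) (use ends row_ne uv row_sorted row_range row_gap in blast)+
  have "set (gaps (concat (map row [Suc m..<Suc (2 * m)]))) \<subseteq> {u (Suc m)<..<v (2 * m)}"
    by (rule sorted_gaps_concat(2)[of _ _ row u v]) (use ends row_ne uv row_sorted row_range row_gap in blast)+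
  then have pos: "\<forall>d\<in>set (gaps (concat (map row [Suc m..<Suc (2 * m)]))). 0 < d"
    by (force simp: u_def)
  \<comment> \<open>Each of the m rows runs from at most 2 m to at least 4 m.\<close>
  have "2 * m \<le> length (row s)" if "Suc m \<le> s" "s \<le> 2 * m" for s
    using l[of s] r(1)[of s] that by (simp add: row_def del: upt_Suc)
  then have "(\<Sum>s\<leftarrow>[Suc m..<Suc (2 * m)]. 2 * m) \<le> (\<Sum>s\<leftarrow>[Suc m..<Suc (2 * m)]. length (row s))"
    by (intro sum_list_mono) (auto simp del: upt_Suc)
  then have "2 * m\<^sup>2 \<le> length (concat (map row [Suc m..<Suc (2 * m)]))"
    by (simp add: length_concat sum_list_triv power2_eq_square comp_def del: upt_Suc)
  then have "2 * m\<^sup>2 \<le> card A"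
    unfolding A_def convex_set_set(2)[OF D pos] .
  moreover have "convex_set A"
    unfolding A_def by (rule convex_set_set(1)[OF D pos])
  moreover have "A \<subseteq> (\<lambda>(i, j). x i + y j) ` ({..10 * m} \<times> {-10 * int m..2 * int m})"
  proof
    fix z
    assume "z \<in> A"
    then obtain s i where s: "Suc m \<le> s" "s \<le> 2 * m" and i: "i \<le> r s" "z = a s i"
      by (auto simp: A_def row_def less_Suc_eq_le simp del: upt_Suc)
    then have "i \<le> 10 * m"
      using r(2)[of s] by simp
    then show "z \<in> (\<lambda>(i, j). x i + y j) ` ({..10 * m} \<times> {-10 * int m..2 * int m})"
      using s i(2) by (intro image_eqI[of _ _ "(i, int s - int i)"]) (auto simp: a)
  qed
  ultimately show thesis
    using that by blast
qed

section \<open>The Sidon bound for the constructed set\<close>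

theorem theorem1p5:
  shows "\<exists>C::real. C > 0 \<and>
    (\<forall>N::nat. \<exists>A::real set. convex_set A \<and> card A \<ge> N \<and>
       real (max_sidon A) \<le> C * real (card A) powr (3 / 4))"
proof (intro exI[of _ "2 * 169 powr (3 / 4)"] conjI allI)
  fix N :: nat
  define m where "m = Suc N"
  obtain A and x :: "nat \<Rightarrow> real" and y :: "int \<Rightarrow> real" where A: "convex_set A" "2 * m\<^sup>2 \<le> card A"
    "A \<subseteq> (\<lambda>(i, j). x i + y j) ` ({..10 * m} \<times> {-10 * int m..2 * int m})"
    using convex_in_sumset[of m] by (auto simp: m_def)
  \<comment> \<open>The index sets have 10 m + 1 and 12 m + 1 elements, both at most 13 m. The
    constant comes from 2 M^(3/2) = 2 (M^2)^(3/4) and M^2 = 169 m^2 \<le> 169 |A|.\<close>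
  define M where "M = 13 * real m"
  have "N \<le> 2 * m\<^sup>2"
    by (simp add: m_def power2_eq_square)
  then have N: "N \<le> card A"
    using A(2) by simp
  have "real (card B) \<le> 2 * 169 powr (3 / 4) * real (card A) powr (3 / 4)"
    if B: "B \<subseteq> A" "sidon B" for B
  proof -
    have I: "real (card {..10 * m}) \<le> M" "real (card {-10 * int m..2 * int m}) \<le> M"
      by (auto simp: M_def m_def)
    have "(card B)\<^sup>2 \<le> card {..10 * m} * (card B + (card {-10 * int m..2 * int m})\<^sup>2)"
      using B A(3) by (intro sidon_sumset_card[of _ _ B x y]) auto
    then have "(real (card B))\<^sup>2 \<le>
        real (card {..10 * m}) * (real (card B) + (real (card {-10 * int m..2 * int m}))\<^sup>2)"
      unfolding of_nat_power[symmetric] of_nat_add[symmetric] of_nat_mult[symmetric] of_nat_le_iff .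
    also have "\<dots> \<le> M * (real (card B) + M\<^sup>2)"
      using I by (intro mult_mono add_left_mono power_mono) (auto simp: M_def)
    finally have "real (card B) \<le> 2 * M powr (3 / 2)"
      by (intro quadratic_bound) (auto simp: M_def m_def)
    also have "M powr (3 / 2) = (M powr 2) powr (3 / 4)"
      by (simp add: powr_powr)
    also have "M powr 2 = 169 * (real m)\<^sup>2"
      by (simp add: M_def power2_eq_square m_def algebra_simps)
    also have "(169 * (real m)\<^sup>2) powr (3 / 4) \<le> (169 * real (card A)) powr (3 / 4)"
    proof (intro powr_mono2 mult_left_mono)
      have "m\<^sup>2 \<le> card A"
        using A(2) by simp
      then show "(real m)\<^sup>2 \<le> real (card A)"
        unfolding of_nat_power[symmetric] of_nat_le_iff .
    qed auto
    also have "\<dots> = 169 powr (3 / 4) * real (card A) powr (3 / 4)"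
      by (simp add: powr_mult)
    finally show ?thesis by simp
  qed
  moreover have "max_sidon A \<in> {card B | B. B \<subseteq> A \<and> sidon B}"
    unfolding max_sidon_def
  proof (rule Max_in)
    have "finite A"
      using A(1) by (simp add: convex_set_def)
    then show "finite {card B | B. B \<subseteq> A \<and> sidon B}"
      by simp
    show "{card B | B. B \<subseteq> A \<and> sidon B} \<noteq> {}"
      by (auto simp: sidon_def intro!: exI[of _ "{}"])
  qed
  ultimately have "real (max_sidon A) \<le> 2 * 169 powr (3 / 4) * real (card A) powr (3 / 4)"
    by force
  with A(1) N show "\<exists>A::real set. convex_set A \<and> card A \<ge> N \<and>
       real (max_sidon A) \<le> 2 * 169 powr (3 / 4) * real (card A) powr (3 / 4)"
    by (intro exI[of _ A] conjI)
qed simp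

end
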